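(* Let $k\ge1$, and let $p$ be the mesh pattern $(12\cdots k,R)$ of length $k$, whose $k$ elements are in increasing order and in which all boxes are shaded except the top-left and the bottom-right ones, i.e. $R=\big(\{0,\dots,k\}\times\{0,\dots,k\}\big)\setminus\{(0,k),(k,0)\}$. Then the avoidance and distribution of $p$ are given by $$A_p(x)=\frac{F(x)}{1+x^kF(x)},\qquad F_p(x,q)=\frac{F(x)}{1+(1-q)x^kF(x)}.$$
   Context: $S_n$ is the set of permutations of $\{1,\dots,n\}$, $n\ge 0$ ($S_0$ consists of the empty permutation). A mesh pattern of length $k$ is a pair $(\tau,R)$ with $\tau\in S_k$ and $R\subseteq\{0,\dots,k\}\times\{0,\dots,k\}$ (the shaded boxes). Given $\pi=\pi_1\cdots\pi_n\in S_n$ and positions $i_1<\dots<i_k$, let $v_1<\dots<v_k$ be the values $\pi_{i_1},\dots,\pi_{i_k}$ sorted increasingly, and put $i_0=v_0=0$, $i_{k+1}=v_{k+1}=n+1$. The box $(r,s)$ contains the elements $\pi_j$ with $i_r<j<i_{r+1}$ and $v_s<\pi_j<v_{s+1}$. The subsequence $\pi_{i_1}\cdots\pi_{i_k}$ is an occurrence of $(\tau,R)$ if it is order-isomorphic to $\tau$ and every box in $R$ contains no element of $\pi$. For a mesh pattern $p$, $p(\pi)$ is the number of occurrences of $p$ in $\pi$, $F_p(x,q)=\sum_{n\ge0}x^n\sum_{\pi\in S_n}q^{p(\pi)}$, $A_p(x)=\sum_{n\ge 0}x^n\,|\{\pi\in S_n: p(\pi)=0\}|$, and $F(x)=\sum_{n\ge0}n!\,x^n$.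 All are formal power series. *)

theory Defs
  imports
    "HOL-Combinatorics.Multiset_Permutations"
    "HOL-Computational_Algebra.Formal_Power_Series"
begin

text \<open>
  Permutations of size \<open>n\<close> are written in one-line notation, as lists of length \<open>n\<close>; the entry
  \<open>\<pi>\<^sub>j\<close> (with \<open>1 \<le> j \<le> n\<close>) is \<open>\<pi> ! (j - 1)\<close>.
\<close>

definition perms :: "nat \<Rightarrow> nat list set" where
  "perms n = permutations_of_set {1..n}"

text \<open>A mesh pattern \<open>(\<tau>, R)\<close> of length \<open>k = length \<tau>\<close>.\<close>

type_synonym mesh_pattern = "nat list \<times> (nat \<times> nat) set"

definition order_isomorphic :: "nat list \<Rightarrow> nat list \<Rightarrow> bool" where
  "order_isomorphic xs ys \<longleftrightarrow> length xs = length ys \<and>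
     (\<forall>a < length xs. \<forall>b < length xs. xs ! a < xs ! b \<longleftrightarrow> ys ! a < ys ! b)"

definition subseq_at :: "nat list \<Rightarrow> nat list \<Rightarrow> nat list" where
  "subseq_at \<pi> js = map (\<lambda>j. \<pi> ! (j - 1)) js"

text \<open>
  For positions \<open>js = [i\<^sub>1, \<dots>, i\<^sub>k]\<close>, entry \<open>r\<close> of \<open>ext_positions \<pi> js\<close> is \<open>i\<^sub>r\<close> and entry \<open>s\<close> of
  \<open>ext_values \<pi> js\<close> is \<open>v\<^sub>s\<close>, for \<open>0 \<le> r, s \<le> k + 1\<close>.
\<close>

definition ext_positions :: "nat list \<Rightarrow> nat list \<Rightarrow> nat list" where
  "ext_positions \<pi> js = 0 # js @ [length \<pi> + 1]"

definition ext_values :: "nat list \<Rightarrow> nat list \<Rightarrow> nat list" where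
  "ext_values \<pi> js = 0 # sort (subseq_at \<pi> js) @ [length \<pi> + 1]"

definition box :: "nat list \<Rightarrow> nat list \<Rightarrow> nat \<Rightarrow> nat \<Rightarrow> nat set" where
  "box \<pi> js r s = {\<pi> ! (j - 1) | j.
     ext_positions \<pi> js ! r < j \<and> j < ext_positions \<pi> js ! (r + 1) \<and>
     ext_values \<pi> js ! s < \<pi> ! (j - 1) \<and> \<pi> ! (j - 1) < ext_values \<pi> js ! (s + 1)}"

text \<open>An occurrence is represented by the increasing list of its positions.\<close>

definition occurrences :: "mesh_pattern \<Rightarrow> nat list \<Rightarrow> nat list set" where
  "occurrences p \<pi> = {js. sorted_wrt (<) js \<and> set js \<subseteq> {1..length \<pi>} \<and>
     order_isomorphic (subseq_at \<pi> js) (fst p) \<and> (\<forall>(r, s) \<in> snd p. box \<pi> js r s = {})}"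

definition num_occurrences :: "mesh_pattern \<Rightarrow> nat list \<Rightarrow> nat" where
  "num_occurrences p \<pi> = card (occurrences p \<pi>)"

definition avoidance_gf :: "mesh_pattern \<Rightarrow> rat fps" where
  "avoidance_gf p = Abs_fps (\<lambda>n. of_nat (card {\<pi> \<in> perms n. num_occurrences p \<pi> = 0}))"

text \<open>
  Series in \<open>x\<close> and \<open>q\<close> are series in \<open>x\<close> whose coefficients are series in \<open>q\<close>: on the type
  \<^typ>\<open>rat fps fps\<close> the variable \<open>x\<close> is \<^term>\<open>fps_X :: rat fps fps\<close> and \<open>q\<close> is
  \<^term>\<open>fps_const fps_X :: rat fps fps\<close>.
\<close>

definition distribution_gf :: "mesh_pattern \<Rightarrow> rat fps fps" where
  "distribution_gf p = Abs_fps (\<lambda>n. \<Sum>\<pi>\<in>perms n. fps_X ^ num_occurrences p \<pi>)"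

definition fact_gf :: "'a :: semiring_char_0 fps" where
  "fact_gf = Abs_fps (\<lambda>n. fact n)"

text \<open>
  The coefficient ring \<^typ>\<open>rat fps\<close> is not a field; nevertheless, division on \<^typ>\<open>rat fps fps\<close>
  is division in the ring whenever the denominator has constant coefficient 1.
\<close>

lemma fps_fps_divide_times:
  fixes f g :: "rat fps fps"
  assumes "fps_nth g 0 = 1"
  shows "f / g * g = f"
proof -
  have inv: "inverse (fps_nth g 0) = 1"
    using assms by (simp add: fps_inverse_one')
  then have "inverse g * g = 1"
    using assms fps_right_inverse[of g 1]
    by (simp only: fps_inverse_def[of g] mult.commute[of _ g]) simp
  then show ?thesis
    using assms by (simp add: fps_divide_unit mult.assoc)
qed

end

theory Submission
  imports Defs
begin

text \<open>
  Only the top-left and the bottom-right box may contain elements, so an occurrence of the pattern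
  in \<open>\<pi>\<close> is a run of \<open>k\<close> consecutive positions carrying \<open>k\<close> consecutive increasing values, with every
  earlier entry larger and every later entry smaller than all of them. In other words, \<open>\<pi>\<close> is a skew
  sum \<open>A \<ominus> 12\<dots>k \<ominus> B\<close>, and an occurrence is determined by the size of \<open>A\<close> (lemmas
  \<open>occurrence_is_block\<close> and \<open>block_is_occurrence\<close>). Since \<open>12\<dots>k\<close> is not a skew sum of smaller
  permutations, two occurrences never overlap; hence the occurrences to the right of a chosen one are
  exactly the occurrences in \<open>B\<close>.

  This gives an equation for the series \<open>G\<close> that weights \<open>\<pi>\<close> by \<open>q\<close> to the number of its
  occurrences. The product \<open>x\<^sup>k F(x) G\<close> counts pairs \<open>(A, B)\<close>, weighted by the occurrences in \<open>B\<close>, that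
  is, permutations \<open>\<pi>\<close> with a chosen occurrence, weighted by the occurrences to its right. For a
  fixed \<open>\<pi>\<close> with \<open>m\<close> occurrences, the choices contribute
  \<open>1 + q + \<dots> + q\<^bsup>m-1\<^esup>\<close>, and \<open>1 - q\<close> times this sum is \<open>1 - q\<^sup>m\<close>. Summing over all \<open>\<pi>\<close> yields
  \<open>(1 - q) x\<^sup>k F(x) G = F(x) - G\<close> (lemma \<open>occurrence_gf_equation\<close>). The argument works for an element
  \<open>q\<close> of any commutative coefficient ring of characteristic 0: the indeterminate \<open>q\<close> gives the
  distribution, and \<open>q = 0\<close> gives the avoidance.
\<close>

\<comment> \<open>Intervals of consecutive positions and values are kept as intervals, not unrolled at the end.\<close>
declare upt_Suc [simp del]

text \<open>
  The first \<open>i\<close> entries, the next \<open>k\<close> entries and the rest are the three summands of a skew sum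
  \<open>A \<ominus> 12\<dots>k \<ominus> B\<close>. Positions count from 0 here, as in \<^term>\<open>(!)\<close>, while the elements of an occurrence
  count from 1, so the block at \<open>i\<close> is the occurrence \<open>i + 1, \<dots>, i + k\<close>.
\<close>

definition increasing_block :: "nat \<Rightarrow> nat list \<Rightarrow> nat \<Rightarrow> bool" where
  "increasing_block k \<pi> i \<longleftrightarrow> i + k \<le> length \<pi> \<and>
     (\<forall>m < i. length \<pi> - i < \<pi> ! m) \<and>
     (\<forall>m < k. \<pi> ! (i + m) = length \<pi> - i - k + 1 + m) \<and>
     (\<forall>m. i + k \<le> m \<and> m < length \<pi> \<longrightarrow> \<pi> ! m \<le> length \<pi> - i - k)"

text \<open>
  The skew sum \<open>A \<ominus> 12\<dots>k \<ominus> B\<close>.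
\<close>

definition skew_glue :: "nat \<Rightarrow> nat list \<Rightarrow> nat list \<Rightarrow> nat list" where
  "skew_glue k A B =
     map (\<lambda>x. x + (k + length B)) A @ [length B + 1..<length B + 1 + k] @ B"

definition increasing_mesh :: "nat \<Rightarrow> mesh_pattern" where
  "increasing_mesh k = ([1..<k + 1], ({0..k} \<times> {0..k}) - {(0, k), (k, 0)})"

lemma in_perms_iff: "\<pi> \<in> perms n \<longleftrightarrow> distinct \<pi> \<and> set \<pi> = {1..n}"
  by (auto simp: perms_def permutations_of_set_def)

lemma length_perms: "\<pi> \<in> perms n \<Longrightarrow> length \<pi> = n"
  using distinct_card[of \<pi>] by (simp add: in_perms_iff)

lemma finite_perms: "finite (perms n)"
  by (simp add: perms_def)

lemma card_perms: "card (perms n) = fact n"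
  by (simp add: perms_def)

lemma permsI_subset:
  assumes "distinct \<pi>" and "set \<pi> \<subseteq> {1..length \<pi>}"
  shows "\<pi> \<in> perms (length \<pi>)"
  using assms card_subset_eq[of "{1..length \<pi>}" "set \<pi>"] distinct_card[of \<pi>]
  by (simp add: in_perms_iff)

section \<open>Occurrences are blocks\<close>

text \<open>
  Applied to the positions and to the values of an occurrence, this finds the column and the row of
  the box that contains a given element. The gap is the first one whose right end exceeds \<open>x\<close>, so
  \<open>xs\<close> may be in any order.
\<close>

lemma exists_enclosing_gap:
  fixes xs :: "nat list"
  assumes "0 < x" "x < N" "x \<notin> set xs"
  shows "\<exists>r \<le> length xs. (0 # xs @ [N]) ! r < x \<and> x < (0 # xs @ [N]) ! (r + 1)"
proof -
  let ?e = "0 # xs @ [N]"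
  let ?P = "\<lambda>r. x < ?e ! (r + 1)"
  have last: "?P (length xs)" using assms by (simp add: nth_append)
  define r where "r = (LEAST r. ?P r)"
  have P: "?P r" unfolding r_def by (rule LeastI[of ?P, OF last])
  have le: "r \<le> length xs" unfolding r_def by (rule Least_le[of ?P, OF last])
  have "?e ! r < x"
  proof (cases r)
    case 0
    then show ?thesis using assms by simp
  next
    case (Suc r')
    then have "\<not> ?P r'" using not_less_Least[of r' ?P] by (simp add: r_def)
    moreover have "?e ! r = xs ! r'" "r' < length xs" using Suc le by (auto simp: nth_append)
    ultimately show ?thesis using assms(3) Suc
      by (metis Suc_eq_plus1 linorder_neqE_nat nth_mem)
  qed
  with P le show ?thesis by blast
qed

text \<open>
  The positions of an occurrence fill an interval, and so do its values; this turns both facts into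
  explicit lists.
\<close>

lemma strict_sorted_eq_upt:
  fixes xs :: "nat list"
  assumes "sorted_wrt (<) xs" "xs \<noteq> []" "{hd xs..last xs} \<subseteq> set xs"
  shows "xs = [hd xs..<hd xs + length xs]"
proof -
  have *: "hd xs \<le> x \<and> x \<le> last xs" if x: "x \<in> set xs" for x
  proof -
    obtain a where a: "a < length xs" "x = xs ! a" using x by (auto simp: in_set_conv_nth)
    have s: "sorted xs" using assms(1) by (simp add: strict_sorted_iff)
    show ?thesis using a assms(2) sorted_nth_mono[OF s, of 0 a] sorted_nth_mono[OF s, of a "length xs - 1"]
      by (auto simp: hd_conv_nth last_conv_nth)
  qed
  then have set: "set xs = set [hd xs..<last xs + 1]"
    using assms(3) by (fastforce simp: less_Suc_eq_le)
  have eq: "xs = [hd xs..<last xs + 1]"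
    using assms(1) set by (intro sorted_distinct_set_unique) (auto simp: strict_sorted_iff)
  then have "length xs = last xs + 1 - hd xs" by (metis length_upt)
  moreover have "hd xs \<le> last xs" using * assms(2) by simp
  ultimately show ?thesis using eq by simp
qed

text \<open>
  Every element outside the occurrence lies in some box, which must be one of the two unshaded ones:
  it comes before the occurrence and above it, or after and below. So no position between the first
  and the last one is skipped, nor any value. The values below the occurrence are then exactly
  the entries after it, and counting them fixes the smallest value of the occurrence.
\<close>

lemma occurrence_is_block:
  assumes k: "k \<ge> 1" and \<pi>: "\<pi> \<in> perms n"
    and js: "js \<in> occurrences (increasing_mesh k) \<pi>"
  shows "\<exists>i. js = [i + 1..<i + 1 + k] \<and> increasing_block k \<pi> i"
proof -
  have n: "length \<pi> = n" and d: "distinct \<pi>" and s\<pi>: "set \<pi> = {1..n}"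
    using \<pi> by (auto simp: length_perms in_perms_iff)
  define vs where "vs = subseq_at \<pi> js"
  have sjs: "sorted_wrt (<) js" and sub: "set js \<subseteq> {1..n}"
    and iso: "order_isomorphic vs [1..<k + 1]"
    and boxes: "\<forall>(r, s) \<in> {0..k} \<times> {0..k} - {(0, k), (k, 0)}. box \<pi> js r s = {}"
    using js n by (simp_all add: occurrences_def increasing_mesh_def vs_def)
  have lvs: "length vs = k" and ljs: "length js = k"
    using iso by (auto simp: order_isomorphic_def vs_def subseq_at_def)
  have ne: "vs \<noteq> []" "js \<noteq> []" using lvs ljs k by auto
  have svs: "sorted_wrt (<) vs"
    using iso by (auto simp: order_isomorphic_def sorted_wrt_iff_nth_less)
  then have sort: "sort vs = vs" by (simp add: strict_sorted_iff sort_key_id_if_sorted sorted_sort_id)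
  have setvs: "set vs = (\<lambda>j. \<pi> ! (j - 1)) ` set js" by (simp add: vs_def subseq_at_def)
  have val: "\<pi> ! (j - 1) \<in> {1..n}" if "j \<in> {1..n}" for j
    using that n s\<pi> nth_mem[of "j - 1" \<pi>] by auto
  then have subvs: "set vs \<subseteq> {1..n}" using sub unfolding setvs by blast
  have outside: "(j < hd js \<and> last vs < \<pi> ! (j - 1)) \<or> (last js < j \<and> \<pi> ! (j - 1) < hd vs)"
    if j: "j \<in> {1..n}" "j \<notin> set js" for j
  proof -
    let ?v = "\<pi> ! (j - 1)"
    have v: "?v \<in> {1..n}" using val[OF j(1)] .
    have "?v \<notin> set vs"
    proof
      assume "?v \<in> set vs"
      then obtain j' where j': "j' \<in> set js" "\<pi> ! (j - 1) = \<pi> ! (j' - 1)" by (auto simp: setvs)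
      then have "j' \<in> {1..n}" using sub by auto
      then have "j - 1 = j' - 1" using j' j d n nth_eq_iff_index_eq[of \<pi> "j - 1" "j' - 1"] by auto
      then have "j = j'" using \<open>j' \<in> {1..n}\<close> j(1) unfolding atLeastAtMost_iff by linarith
      then show False using j(2) j'(1) by simp
    qed
    then obtain s where s: "s \<le> k" "ext_values \<pi> js ! s < ?v" "?v < ext_values \<pi> js ! (s + 1)"
      using exists_enclosing_gap[of ?v "n + 1" vs] v lvs n
      by (auto simp: ext_values_def sort simp flip: vs_def)
    obtain r where r: "r \<le> k" "ext_positions \<pi> js ! r < j" "j < ext_positions \<pi> js ! (r + 1)"
      using exists_enclosing_gap[of j "n + 1" js] j ljs n by (auto simp: ext_positions_def)
    have "?v \<in> box \<pi> js r s" unfolding box_def using r s by blast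
    then have "(r, s) = (0, k) \<or> (r, s) = (k, 0)" using boxes r s by fastforce
    then show ?thesis using r s ne lvs ljs k
      by (auto simp: ext_values_def ext_positions_def sort nth_append hd_conv_nth last_conv_nth nth_Cons'
          simp flip: vs_def)
  qed
  have "{hd js..last js} \<subseteq> set js"
  proof
    fix j assume j: "j \<in> {hd js..last js}"
    moreover have "hd js \<in> {1..n}" "last js \<in> {1..n}"
      using subsetD[OF sub hd_in_set[OF ne(2)]] subsetD[OF sub last_in_set[OF ne(2)]] .
    ultimately show "j \<in> set js" using outside[of j] by fastforce
  qed
  then have "js = [hd js..<hd js + k]" using strict_sorted_eq_upt[OF sjs] ne ljs by simp
  moreover define i where "i = hd js - 1"
  moreover have hj: "hd js \<in> {1..n}" using subsetD[OF sub hd_in_set[OF ne(2)]] .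
  ultimately have jseq: "js = [i + 1..<i + 1 + k]" by simp
  have "{hd vs..last vs} \<subseteq> set vs"
  proof
    fix v assume v: "v \<in> {hd vs..last vs}"
    have "hd vs \<in> {1..n}" "last vs \<in> {1..n}"
      using subsetD[OF subvs hd_in_set[OF ne(1)]] subsetD[OF subvs last_in_set[OF ne(1)]] .
    then have "v \<in> set \<pi>" using v s\<pi> by auto
    then obtain m where m: "m < n" "\<pi> ! m = v" using n by (auto simp: in_set_conv_nth)
    show "v \<in> set vs"
    proof (cases "m + 1 \<in> set js")
      case True
      then show ?thesis using m setvs by force
    next
      case False
      then show ?thesis using outside[of "m + 1"] m v by auto
    qed
  qed
  then have vs1: "vs = [hd vs..<hd vs + k]" using strict_sorted_eq_upt[OF svs] ne lvs by simp
  have hv: "hd vs \<in> {1..n}" using subsetD[OF subvs hd_in_set[OF ne(1)]] .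
  define c where "c = hd vs - 1"
  have vseq: "vs = [c + 1..<c + 1 + k]" using vs1 hv by (simp add: c_def)
  have ik: "i + k \<le> n"
  proof -
    have "i + k \<in> set js" using jseq k by simp
    then show ?thesis using sub by auto
  qed
  have hdlast: "hd js = i + 1" "last js = i + k" "hd vs = c + 1" "last vs = c + k"
    using jseq vseq k by (auto simp: hd_conv_nth last_conv_nth)
  have mid: "\<pi> ! (i + m) = c + 1 + m" if "m < k" for m
  proof -
    have "vs ! m = \<pi> ! (js ! m - 1)" using that ljs by (simp add: vs_def subseq_at_def)
    then show ?thesis using that vseq jseq by simp
  qed
  have before: "c + k < \<pi> ! m" if "m < i" for m
    using outside[of "m + 1"] that ik hdlast jseq by auto
  have after: "\<pi> ! m \<le> c" if "i + k \<le> m" "m < n" for m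
    using outside[of "m + 1"] that ik hdlast jseq k by auto
  \<comment> \<open>The smallest value of the occurrence is found by counting the smaller ones.\<close>
  have "set (drop (i + k) \<pi>) = {1..c}"
  proof (intro equalityI subsetI)
    fix v assume v: "v \<in> set (drop (i + k) \<pi>)"
    then obtain m where "m < length (drop (i + k) \<pi>)" "v = drop (i + k) \<pi> ! m"
      unfolding in_set_conv_nth by blast
    then have "i + k + m < n" "v = \<pi> ! (i + k + m)"
      using n ik by auto
    then have "v \<le> c" using after[of "i + k + m"] by simp
    moreover have "v \<in> set \<pi>" using v by (rule in_set_dropD)
    ultimately show "v \<in> {1..c}" using s\<pi> by auto
  next
    fix v assume v: "v \<in> {1..c}"
    then have "v \<in> set \<pi>" using hv s\<pi> by (auto simp: c_def)
    then obtain m where m: "m < n" "\<pi> ! m = v" using n by (auto simp: in_set_conv_nth)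
    have "i + k \<le> m"
    proof (rule ccontr)
      assume "\<not> i + k \<le> m"
      then consider "m < i" | "m - i < k" "i + (m - i) = m" by linarith
      then show False using before[of m] mid[of "m - i"] m v by cases auto
    qed
    then have "v = drop (i + k) \<pi> ! (m - (i + k))" "m - (i + k) < length (drop (i + k) \<pi>)"
      using m n by auto
    then show "v \<in> set (drop (i + k) \<pi>)" by (metis nth_mem)
  qed
  then have "c = n - i - k"
    using distinct_card[OF distinct_drop[OF d, of "i + k"]] n by simp
  then have "increasing_block k \<pi> i"
    using n ik before mid after by (auto simp: increasing_block_def)
  with jseq show ?thesis by blast
qed

lemma block_is_occurrence:
  assumes k: "k \<ge> 1" and \<pi>: "\<pi> \<in> perms n" and b: "increasing_block k \<pi> i"
  shows "[i + 1..<i + 1 + k] \<in> occurrences (increasing_mesh k) \<pi>"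
proof -
  have n: "length \<pi> = n" using \<pi> by (rule length_perms)
  define c where "c = n - i - k"
  have ik: "i + k \<le> n" and before: "\<And>m. m < i \<Longrightarrow> c + k < \<pi> ! m"
    and mid: "\<And>m. m < k \<Longrightarrow> \<pi> ! (i + m) = c + 1 + m"
    and after: "\<And>m. i + k \<le> m \<Longrightarrow> m < n \<Longrightarrow> \<pi> ! m \<le> c"
    using b n by (auto simp: increasing_block_def c_def)
  let ?js = "[i + 1..<i + 1 + k]"
  have vs: "subseq_at \<pi> ?js = [c + 1..<c + 1 + k]"
    by (rule nth_equalityI) (use mid in \<open>auto simp: subseq_at_def\<close>)
  have P: "ext_positions \<pi> ?js ! r = (if r = 0 then 0 else if r \<le> k then i + r else n + 1)"
    if "r \<le> k + 1" for r
    using that n by (cases r) (auto simp: ext_positions_def nth_append)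
  have V: "ext_values \<pi> ?js ! s = (if s = 0 then 0 else if s \<le> k then c + s else n + 1)"
    if "s \<le> k + 1" for s
    unfolding ext_values_def vs using that n
    by (cases s) (auto simp: nth_append sorted_sort_id)
  have "(r, s) = (0, k) \<or> (r, s) = (k, 0)" if rs: "r \<le> k" "s \<le> k" and x: "x \<in> box \<pi> ?js r s" for r s x
  proof -
    obtain j where j: "ext_positions \<pi> ?js ! r < j" "j < ext_positions \<pi> ?js ! (r + 1)"
      "ext_values \<pi> ?js ! s < \<pi> ! (j - 1)" "\<pi> ! (j - 1) < ext_values \<pi> ?js ! (s + 1)"
      using x unfolding box_def by blast
    \<comment> \<open>The inner columns contain no position at all, because the block is contiguous.\<close>
    consider "r = 0" "j - 1 < i" | "r = k" "i + k \<le> j - 1" "j - 1 < n"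
      using j(1,2) rs k ik P[of r] P[of "r + 1"] by (auto split: if_splits)
    then show ?thesis
    proof cases
      case 1
      then show ?thesis using before[of "j - 1"] j(4) rs V[of "s + 1"] by (auto split: if_splits)
    next
      case 2
      then show ?thesis using after[of "j - 1"] j(3) rs V[of s] by (auto split: if_splits)
    qed
  qed
  then have "\<forall>(r, s) \<in> snd (increasing_mesh k). box \<pi> ?js r s = {}"
    by (fastforce simp: increasing_mesh_def)
  moreover have "order_isomorphic (subseq_at \<pi> ?js) [1..<k + 1]"
    unfolding vs by (auto simp: order_isomorphic_def)
  ultimately show ?thesis using ik n
    by (auto simp: occurrences_def increasing_mesh_def sorted_wrt_upt)
qed

text \<open>
  The case \<open>k = 0\<close> must be excluded: the empty pattern occurs once, but every cut of a skew sum would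
  be a block.
\<close>

lemma num_occurrences_eq_card_blocks:
  assumes "k \<ge> 1" and "\<pi> \<in> perms n"
  shows "num_occurrences (increasing_mesh k) \<pi> = card {i. increasing_block k \<pi> i}"
proof -
  have "occurrences (increasing_mesh k) \<pi> = (\<lambda>i. [i + 1..<i + 1 + k]) ` {i. increasing_block k \<pi> i}"
    using occurrence_is_block[OF assms] block_is_occurrence[OF assms] by blast
  moreover have "inj (\<lambda>i. [i + 1..<i + 1 + k])"
  proof (rule injI)
    fix i j assume "[i + 1..<i + 1 + k] = [j + 1..<j + 1 + k]"
    then have "hd [i + 1..<i + 1 + k] = hd [j + 1..<j + 1 + k]" by (simp only:)
    then show "i = j" using assms(1) by simp
  qed
  ultimately show ?thesis
    unfolding num_occurrences_def by (metis card_image inj_on_subset subset_UNIV)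
qed

section \<open>Cutting a permutation at a block\<close>

lemma length_skew_glue: "length (skew_glue k A B) = length A + k + length B"
  by (simp add: skew_glue_def)

lemma skew_glue_nth:
  "m < length A \<Longrightarrow> skew_glue k A B ! m = A ! m + (k + length B)"
  "m < k \<Longrightarrow> skew_glue k A B ! (length A + m) = length B + 1 + m"
  "skew_glue k A B ! (length A + k + m) = B ! m"
  by (auto simp: skew_glue_def nth_append)

lemma skew_glue_in_perms:
  assumes "A \<in> perms a" "B \<in> perms b"
  shows "skew_glue k A B \<in> perms (a + k + b)"
proof -
  have l: "length A = a" "length B = b" using assms by (auto simp: length_perms)
  have d: "distinct A" "distinct B" and sets: "set A = {1..a}" "set B = {1..b}"
    using assms by (auto simp: in_perms_iff)
  have set: "set (skew_glue k A B) = (\<lambda>x. x + (k + b)) ` {1..a} \<union> {b + 1..<b + 1 + k} \<union> {1..b}"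
    by (simp add: skew_glue_def l sets Un_assoc)
  have "distinct (skew_glue k A B)"
    using d by (auto simp: skew_glue_def l sets distinct_map)
  moreover have "set (skew_glue k A B) \<subseteq> {1..length (skew_glue k A B)}"
    unfolding set length_skew_glue l by auto
  ultimately have "skew_glue k A B \<in> perms (length (skew_glue k A B))"
    by (rule permsI_subset)
  then show ?thesis using l by (simp add: length_skew_glue)
qed

lemma skew_glue_block:
  assumes "A \<in> perms a" "B \<in> perms b"
  shows "increasing_block k (skew_glue k A B) a"
proof -
  have l: "length A = a" "length B = b" using assms by (auto simp: length_perms)
  have A: "1 \<le> A ! m" if "m < a" for m
    using that assms(1) l nth_mem[of m A] by (auto simp: in_perms_iff)
  have B: "B ! m \<le> b" if "m < b" for m
    using that assms(2) l nth_mem[of m B] by (auto simp: in_perms_iff)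
  have "skew_glue k A B ! m \<le> b" if "a + k \<le> m" "m < a + k + b" for m
    using that B[of "m - (a + k)"] skew_glue_nth(3)[where A = A and B = B and k = k and m = "m - (a + k)"] l
    by auto
  moreover have "k + b < skew_glue k A B ! m" if "m < a" for m
    using that A[of m] skew_glue_nth(1)[where A = A and B = B and k = k and m = m] l by auto
  moreover have "skew_glue k A B ! (a + m) = b + 1 + m" if "m < k" for m
    using that skew_glue_nth(2)[where A = A and B = B and k = k and m = m] l by auto
  ultimately show ?thesis
    unfolding increasing_block_def length_skew_glue l by auto
qed

text \<open>
  The inverse cuts \<open>\<pi>\<close> at the block. Once the values of the first part are lowered, both
  outer parts are permutations again, because distinct values within the right bounds exhaust their range.
\<close>

lemma bij_betw_skew_glue:
  assumes "n = a + k + b"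
  shows "bij_betw (\<lambda>(A, B). skew_glue k A B) (perms a \<times> perms b)
    {\<pi> \<in> perms n. increasing_block k \<pi> a}"
  unfolding bij_betw_def
proof
  show "inj_on (\<lambda>(A, B). skew_glue k A B) (perms a \<times> perms b)"
  proof (rule inj_onI, clarify)
    fix A B A' B'
    assume *: "A \<in> perms a" "B \<in> perms b" "A' \<in> perms a" "B' \<in> perms b"
      "skew_glue k A B = skew_glue k A' B'"
    then have "length A = a" "length B = b" "length A' = a" "length B' = b"
      by (auto simp: length_perms)
    with *(5) have "map (\<lambda>x. x + (k + b)) A = map (\<lambda>x. x + (k + b)) A'" "B = B'"
      by (simp_all add: skew_glue_def)
    moreover have "inj (\<lambda>x. x + (k + b))" by simp
    ultimately show "A = A' \<and> B = B'" by (metis inj_map_eq_map)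
  qed
  show "(\<lambda>(A, B). skew_glue k A B) ` (perms a \<times> perms b) = {\<pi> \<in> perms n. increasing_block k \<pi> a}"
  proof (intro equalityI subsetI)
    fix \<pi> assume "\<pi> \<in> (\<lambda>(A, B). skew_glue k A B) ` (perms a \<times> perms b)"
    then show "\<pi> \<in> {\<pi> \<in> perms n. increasing_block k \<pi> a}"
      using skew_glue_in_perms skew_glue_block assms by auto
  next
    fix \<pi> assume "\<pi> \<in> {\<pi> \<in> perms n. increasing_block k \<pi> a}"
    then have \<pi>: "\<pi> \<in> perms n" and bl: "increasing_block k \<pi> a" by auto
    have n: "length \<pi> = n" and d: "distinct \<pi>" and s\<pi>: "set \<pi> = {1..n}"
      using \<pi> by (auto simp: length_perms in_perms_iff)
    have before: "\<And>m. m < a \<Longrightarrow> b + k < \<pi> ! m"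
      and mid: "\<And>m. m < k \<Longrightarrow> \<pi> ! (a + m) = b + 1 + m"
      and after: "\<And>m. a + k \<le> m \<Longrightarrow> m < n \<Longrightarrow> \<pi> ! m \<le> b"
      using bl n assms by (auto simp: increasing_block_def)
    define A where "A = map (\<lambda>x. x - (k + b)) (take a \<pi>)"
    define B where "B = drop (a + k) \<pi>"
    have l: "length A = a" "length B = b" using n assms by (auto simp: A_def B_def)
    have tk: "b + k < x \<and> x \<le> n" if "x \<in> set (take a \<pi>)" for x
    proof -
      have "b + k < x" using that before by (auto simp: in_set_conv_nth)
      moreover have "x \<in> set \<pi>" using that by (rule in_set_takeD)
      ultimately show ?thesis using s\<pi> by auto
    qed
    have dr: "1 \<le> x \<and> x \<le> b" if "x \<in> set (drop (a + k) \<pi>)" for x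
    proof -
      have "x \<le> b" using that after n assms by (auto simp: in_set_conv_nth)
      moreover have "x \<in> set \<pi>" using that by (rule in_set_dropD)
      ultimately show ?thesis using s\<pi> by auto
    qed
    have "inj_on (\<lambda>x. x - (k + b)) (set (take a \<pi>))"
      proof (rule inj_onI)
      fix x y assume "x \<in> set (take a \<pi>)" "y \<in> set (take a \<pi>)" "x - (k + b) = y - (k + b)"
      then show "x = y" using tk[of x] tk[of y] by linarith
    qed
    then have "distinct A" using d by (simp add: A_def distinct_map)
    moreover have "set A \<subseteq> {1..length A}"
    proof
      fix y assume "y \<in> set A"
      then obtain x where x: "x \<in> set (take a \<pi>)" "y = x - (k + b)" by (auto simp: A_def)
      show "y \<in> {1..length A}" using tk[OF x(1)] x(2) l assms by auto
    qed
    ultimately have "A \<in> perms (length A)" by (rule permsI_subset)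
    moreover have "B \<in> perms (length B)"
      using d dr l by (intro permsI_subset) (auto simp: B_def)
    moreover have "skew_glue k A B = \<pi>"
    proof (rule nth_equalityI)
      show "length (skew_glue k A B) = length \<pi>" using l n assms by (simp add: length_skew_glue)
      fix m assume "m < length (skew_glue k A B)"
      then have m: "m < a + k + b" using l by (simp add: length_skew_glue)
      then consider "m < a" | m' where "m = a + m'" "m' < k" | m' where "m = a + k + m'"
        by (metis add_less_cancel_left le_Suc_ex linorder_not_less)
      then show "skew_glue k A B ! m = \<pi> ! m"
      proof cases
        case 1
        then have "skew_glue k A B ! m = A ! m + (k + b)" using skew_glue_nth(1)[where A = A] l by simp
        also have "A ! m = \<pi> ! m - (k + b)" using 1 n assms by (simp add: A_def)
        finally show ?thesis using before[OF 1] by simp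
      next
        case 2
        then show ?thesis using mid skew_glue_nth(2)[where A = A and B = B and m = m'] l by simp
      next
        case 3
        then show ?thesis using skew_glue_nth(3)[where A = A and B = B and m = m'] l n m assms
          by (simp add: B_def)
      qed
    qed
    ultimately show "\<pi> \<in> (\<lambda>(A, B). skew_glue k A B) ` (perms a \<times> perms b)"
      using l by force
  qed
qed

text \<open>
  If a second block started inside the first one, position \<open>j\<close> would be a member of both, and the
  two prescribed values at \<open>j\<close> differ: the values along a block ascend with the position, while the
  smallest values of successive blocks descend.
\<close>

lemma blocks_do_not_overlap:
  assumes "increasing_block k \<pi> i" "increasing_block k \<pi> j" "i < j"
  shows "i + k \<le> j"
proof (rule ccontr)
  assume "\<not> i + k \<le> j"
  then have "j - i < k" "0 < k" using assms(3) by auto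
  then have "\<pi> ! (i + (j - i)) = length \<pi> - i - k + 1 + (j - i)"
    "\<pi> ! (j + 0) = length \<pi> - j - k + 1 + 0"
    using assms(1,2) unfolding increasing_block_def by blast+
  then show False using assms unfolding increasing_block_def by auto
qed

text \<open>
  For a block beyond \<open>A\<close> and the run \<open>12\<dots>k\<close>, the conditions on these entries hold by
  themselves, since they exceed all of \<open>B\<close>; what remains are the conditions on \<open>B\<close>, whose values the
  skew sum does not shift.
\<close>

lemma block_skew_glue_shift:
  assumes "A \<in> perms a" "B \<in> perms b"
  shows "increasing_block k (skew_glue k A B) (a + k + j) \<longleftrightarrow> increasing_block k B j"
proof -
  let ?\<pi> = "skew_glue k A B"
  have l: "length A = a" "length B = b" using assms by (auto simp: length_perms)
  have L: "length ?\<pi> = a + k + b" using l by (simp add: length_skew_glue)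
  have B: "?\<pi> ! (a + k + m) = B ! m" for m
    using skew_glue_nth(3)[where A = A and B = B] l by simp
  have low: "b < ?\<pi> ! m" if m: "m < a + k" for m
  proof (cases "m < a")
    case True
    then show ?thesis
      using skew_glue_block[OF assms, of k] L by (auto simp: increasing_block_def)
  next
    case False
    then show ?thesis
      using skew_glue_nth(2)[where A = A and B = B and k = k and m = "m - a"] l m by simp
  qed
  have 1: "(\<forall>m < a + k + j. b - j < ?\<pi> ! m) \<longleftrightarrow> (\<forall>m < j. b - j < B ! m)" (is "?L \<longleftrightarrow> ?R")
  proof
    assume ?L
    show ?R
    proof (intro allI impI)
      fix m assume "m < j"
      then show "b - j < B ! m" using \<open>?L\<close>[rule_format, of "a + k + m"] B by simp
    qed
  next
    assume ?R
    show ?L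
    proof (intro allI impI)
      fix m assume m: "m < a + k + j"
      show "b - j < ?\<pi> ! m"
      proof (cases "m < a + k")
        case True
        then show ?thesis using low[of m] by simp
      next
        case False
        then show ?thesis using \<open>?R\<close>[rule_format, of "m - (a + k)"] B[of "m - (a + k)"] m by simp
      qed
    qed
  qed
  have 2: "(\<forall>m. a + k + j + k \<le> m \<and> m < a + k + b \<longrightarrow> ?\<pi> ! m \<le> b - j - k) \<longleftrightarrow>
    (\<forall>m. j + k \<le> m \<and> m < b \<longrightarrow> B ! m \<le> b - j - k)" (is "?L \<longleftrightarrow> ?R")
  proof
    assume ?L
    show ?R
    proof (intro allI impI)
      fix m assume "j + k \<le> m \<and> m < b"
      then show "B ! m \<le> b - j - k" using \<open>?L\<close>[rule_format, of "a + k + m"] B by simp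
    qed
  next
    assume ?R
    show ?L
    proof (intro allI impI)
      fix m assume m: "a + k + j + k \<le> m \<and> m < a + k + b"
      then have "j + k \<le> m - (a + k) \<and> m - (a + k) < b" by linarith
      then show "?\<pi> ! m \<le> b - j - k"
        using m \<open>?R\<close>[rule_format, of "m - (a + k)"] B[of "m - (a + k)"] by simp
    qed
  qed
  have "?\<pi> ! (a + k + j + m) = B ! (j + m)" for m using B[of "j + m"] by (simp add: add.assoc)
  with 1 2 show ?thesis unfolding increasing_block_def L l by (simp add: algebra_simps)
qed

lemma card_blocks_after:
  assumes "A \<in> perms a" "B \<in> perms b" and "k \<ge> 1"
  shows "card {j. increasing_block k (skew_glue k A B) j \<and> a < j} = card {j. increasing_block k B j}"
proof -
  have "{j. increasing_block k (skew_glue k A B) j \<and> a < j} =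
    (\<lambda>j. a + k + j) ` {j. increasing_block k B j}"
  proof (intro equalityI subsetI)
    fix j assume j: "j \<in> {j. increasing_block k (skew_glue k A B) j \<and> a < j}"
    then have "a + k \<le> j" using blocks_do_not_overlap skew_glue_block[OF assms(1,2)] by blast
    then obtain j' where "j = a + k + j'" using le_Suc_ex by blast
    then show "j \<in> (\<lambda>j. a + k + j) ` {j. increasing_block k B j}"
      using j block_skew_glue_shift[OF assms(1,2)] by auto
  next
    fix j assume "j \<in> (\<lambda>j. a + k + j) ` {j. increasing_block k B j}"
    then show "j \<in> {j. increasing_block k (skew_glue k A B) j \<and> a < j}"
      using block_skew_glue_shift[OF assms(1,2)] assms(3) by auto
  qed
  then show ?thesis by (simp add: card_image)
qed

section \<open>The generating functions\<close>

text \<open>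
  In decreasing order, the elements of \<open>S\<close> have \<open>0, 1, 2, \<dots>\<close> elements of \<open>S\<close> above them, so this is
  the geometric sum.
\<close>

lemma geometric_sum_later_elements:
  fixes S :: "nat set" and q :: "'a :: comm_ring_1"
  assumes "finite S"
  shows "(1 - q) * (\<Sum>i\<in>S. q ^ card {j \<in> S. i < j}) = 1 - q ^ card S"
  using assms
proof (induction S rule: finite_linorder_min_induct)
  case empty
  then show ?case by simp
next
  case (insert b S)
  have b: "b \<notin> S" using insert by auto
  have "{j \<in> insert b S. b < j} = S" using insert by auto
  moreover have "{j \<in> insert b S. i < j} = {j \<in> S. i < j}" if "i \<in> S" for i
    using insert that by auto
  ultimately have sum: "(\<Sum>i\<in>insert b S. q ^ card {j \<in> insert b S. i < j}) =
      q ^ card S + (\<Sum>i\<in>S. q ^ card {j \<in> S. i < j})"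
    using insert b by simp
  show ?case unfolding sum distrib_left insert.IH using insert b by (simp add: algebra_simps)
qed

text \<open>
  The weight \<open>q\<close> may be any ring element, so that counting avoiders (\<open>q = 0\<close>) and recording the
  distribution (\<open>q\<close> an indeterminate) are instances of the same series.
\<close>

definition occurrence_gf :: "mesh_pattern \<Rightarrow> 'a :: comm_ring_1 \<Rightarrow> 'a fps" where
  "occurrence_gf p q = Abs_fps (\<lambda>n. \<Sum>\<pi>\<in>perms n. q ^ num_occurrences p \<pi>)"

text \<open>
  Double counting of the permutations with a chosen block: cutting at the block leaves \<open>A\<close> free, which
  gives the factorial, and turns the blocks after the chosen one into the occurrences in \<open>B\<close>.
\<close>

lemma sum_over_blocks:
  fixes q :: "'a :: comm_ring_1"
  assumes k: "k \<ge> 1" and le: "k \<le> n"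
  shows "(\<Sum>\<pi>\<in>perms n. \<Sum>i | increasing_block k \<pi> i. q ^ card {j. increasing_block k \<pi> j \<and> i < j}) =
    (\<Sum>a=0..n - k. of_nat (fact a) * (\<Sum>B\<in>perms (n - k - a). q ^ num_occurrences (increasing_mesh k) B))"
    (is "(\<Sum>\<pi>\<in>perms n. \<Sum>i | increasing_block k \<pi> i. ?w \<pi> i) = ?rhs")
proof -
  have "(\<Sum>\<pi>\<in>perms n. \<Sum>i | increasing_block k \<pi> i. ?w \<pi> i) =
      (\<Sum>\<pi>\<in>perms n. \<Sum>i | i \<in> {0..n - k} \<and> increasing_block k \<pi> i. ?w \<pi> i)"
  proof (rule sum.cong[OF refl])
    fix \<pi> assume "\<pi> \<in> perms n"
    then have "{i. increasing_block k \<pi> i} = {i. i \<in> {0..n - k} \<and> increasing_block k \<pi> i}"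
      by (auto simp: increasing_block_def length_perms)
    then show "(\<Sum>i | increasing_block k \<pi> i. ?w \<pi> i) =
        (\<Sum>i | i \<in> {0..n - k} \<and> increasing_block k \<pi> i. ?w \<pi> i)"
      by (rule arg_cong)
  qed
  also have "\<dots> = (\<Sum>a=0..n - k. \<Sum>\<pi> | \<pi> \<in> perms n \<and> increasing_block k \<pi> a. ?w \<pi> a)"
    by (rule sum.swap_restrict) (auto simp: finite_perms)
  also have "\<dots> = ?rhs"
  proof (rule sum.cong[OF refl])
    fix a assume "a \<in> {0..n - k}"
    then have n: "n = a + k + (n - k - a)" using le by auto
    have "(\<Sum>\<pi> | \<pi> \<in> perms n \<and> increasing_block k \<pi> a. ?w \<pi> a) =
        (\<Sum>(A, B)\<in>perms a \<times> perms (n - k - a). ?w (skew_glue k A B) a)"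
      using sum.reindex_bij_betw[OF bij_betw_skew_glue[OF n], of "\<lambda>\<pi>. ?w \<pi> a"]
      by (simp add: case_prod_unfold)
    also have "\<dots> = (\<Sum>(A, B)\<in>perms a \<times> perms (n - k - a). q ^ num_occurrences (increasing_mesh k) B)"
      using card_blocks_after num_occurrences_eq_card_blocks k by (intro sum.cong refl) auto
    also have "\<dots> = of_nat (fact a) * (\<Sum>B\<in>perms (n - k - a). q ^ num_occurrences (increasing_mesh k) B)"
      by (simp add: card_perms flip: sum.cartesian_product)
    finally show "(\<Sum>\<pi> | \<pi> \<in> perms n \<and> increasing_block k \<pi> a. ?w \<pi> a) = \<dots>" .
  qed
  finally show ?thesis .
qed

lemma occurrence_gf_equation:
  fixes q :: "'a :: {comm_ring_1, semiring_char_0}"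
  assumes k: "k \<ge> 1"
  shows "occurrence_gf (increasing_mesh k) q *
    (1 + (1 - fps_const q) * fps_X ^ k * fact_gf) = fact_gf"
proof (rule fps_ext)
  fix n
  let ?G = "occurrence_gf (increasing_mesh k) q"
  let ?blocks = "\<lambda>\<pi>. {i. increasing_block k \<pi> i}"
  have fin: "finite (?blocks \<pi>)" for \<pi>
    by (rule finite_subset[of _ "{..length \<pi>}"]) (auto simp: increasing_block_def)
  have G: "fps_nth ?G n = (\<Sum>\<pi>\<in>perms n. q ^ card (?blocks \<pi>))"
    using num_occurrences_eq_card_blocks[OF k] by (simp add: occurrence_gf_def)
  have "fps_nth (fps_X ^ k * (fact_gf * ?G)) n =
    (\<Sum>\<pi>\<in>perms n. \<Sum>i\<in>?blocks \<pi>. q ^ card {j \<in> ?blocks \<pi>. i < j})"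
  proof (cases "n < k")
    case True
    then have "?blocks \<pi> = {}" if "\<pi> \<in> perms n" for \<pi>
      using that by (auto simp: increasing_block_def length_perms)
    then show ?thesis using True by (simp add: fps_X_power_mult_nth)
  next
    case False
    then have "fps_nth (fps_X ^ k * (fact_gf * ?G)) n = fps_nth (fact_gf * ?G) (n - k)"
      by (simp add: fps_X_power_mult_nth)
    then show ?thesis using sum_over_blocks[OF k, of n q] False
      by (simp add: fps_mult_nth fact_gf_def occurrence_gf_def)
  qed
  then have "(1 - q) * fps_nth (fps_X ^ k * (fact_gf * ?G)) n =
    (\<Sum>\<pi>\<in>perms n. (1 - q) * (\<Sum>i\<in>?blocks \<pi>. q ^ card {j \<in> ?blocks \<pi>. i < j}))"
    by (simp add: sum_distrib_left)
  also have "\<dots> = (\<Sum>\<pi>\<in>perms n. 1 - q ^ card (?blocks \<pi>))"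
    by (simp only: geometric_sum_later_elements[OF fin])
  also have "\<dots> = fact n - fps_nth ?G n"
    by (simp add: G sum_subtractf card_perms)
  finally have eq: "(1 - q) * fps_nth (fps_X ^ k * (fact_gf * ?G)) n = fact n - fps_nth ?G n" .
  have "?G * (1 + (1 - fps_const q) * fps_X ^ k * fact_gf) =
    ?G + fps_const (1 - q) * (fps_X ^ k * (fact_gf * ?G))"
    by (simp add: algebra_simps flip: fps_const_sub)
  then have "fps_nth (?G * (1 + (1 - fps_const q) * fps_X ^ k * fact_gf)) n =
    fps_nth ?G n + (1 - q) * fps_nth (fps_X ^ k * (fact_gf * ?G)) n"
    by (simp only: fps_add_nth fps_mult_left_const_nth)
  then show "fps_nth (?G * (1 + (1 - fps_const q) * fps_X ^ k * fact_gf)) n = fps_nth fact_gf n"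
    by (simp only: eq) (simp add: fact_gf_def)
qed

text \<open>
  Since \<open>0\<^sup>0 = 1\<close>, the weight \<open>q = 0\<close> keeps exactly the permutations without an occurrence.
\<close>

lemma avoidance_gf_eq: "avoidance_gf p = occurrence_gf p 0"
proof (rule fps_ext)
  fix n
  have "(\<Sum>\<pi>\<in>perms n. (0 :: rat) ^ num_occurrences p \<pi>) =
      (\<Sum>\<pi>\<in>perms n. if num_occurrences p \<pi> = 0 then 1 else 0)"
    by (intro sum.cong) auto
  also have "\<dots> = of_nat (card {\<pi> \<in> perms n. num_occurrences p \<pi> = 0})"
    by (simp add: sum.If_cases finite_perms Int_def)
  finally show "fps_nth (avoidance_gf p) n = fps_nth (occurrence_gf p 0) n"
    by (simp add: avoidance_gf_def occurrence_gf_def)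
qed

lemma distribution_gf_eq: "distribution_gf p = occurrence_gf p fps_X"
  by (simp add: distribution_gf_def occurrence_gf_def)

theorem theorem5p7:
  fixes k :: nat and p :: mesh_pattern
  assumes "k \<ge> 1"
    and "p = ([1..<k + 1], ({0..k} \<times> {0..k}) - {(0, k), (k, 0)})"
  shows "avoidance_gf p = fact_gf / (1 + fps_X ^ k * fact_gf)
    \<and> distribution_gf p = fact_gf / (1 + (1 - fps_const fps_X) * fps_X ^ k * fact_gf)"
proof
  have p: "p = increasing_mesh k" using assms(2) by (simp add: increasing_mesh_def)
  let ?d = "1 + fps_X ^ k * fact_gf :: rat fps"
  have "fps_nth ?d 0 = 1" using assms(1) by simp
  then have "?d \<noteq> 0" by (metis fps_zero_nth zero_neq_one)
  moreover have "avoidance_gf p * ?d = fact_gf"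
    using occurrence_gf_equation[OF assms(1), of "0 :: rat"] by (simp add: avoidance_gf_eq p)
  ultimately show "avoidance_gf p = fact_gf / ?d"
    by (metis nonzero_mult_div_cancel_right)
next
  have p: "p = increasing_mesh k" using assms(2) by (simp add: increasing_mesh_def)
  let ?d = "1 + (1 - fps_const fps_X) * fps_X ^ k * fact_gf :: rat fps fps"
  have d0: "fps_nth ?d 0 = 1" using assms(1) by simp
  then have "?d \<noteq> 0" by (metis fps_zero_nth zero_neq_one)
  moreover have "distribution_gf p * ?d = fact_gf / ?d * ?d"
    using occurrence_gf_equation[OF assms(1), of "fps_X :: rat fps"]
    by (simp only: distribution_gf_eq p fps_fps_divide_times[OF d0])
  ultimately show "distribution_gf p = fact_gf / ?d"
    by (simp only: mult_cancel_right) simp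
qed

end
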